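(* Let $R$ be a finite non-local commutative ring with unity. Then the idempotent graph $G_{\mathrm{Id}}(R)$ is not outerplanar.
   Context: For a ring $R$ with unity, an element $x\in R$ is idempotent if $x^2=x$; $\mathrm{Id}(R)$ denotes the set of idempotents of $R$. The idempotent graph $G_{\mathrm{Id}}(R)$ is the simple undirected graph with vertex set $R$ in which two distinct vertices $x,y$ are adjacent if and only if $x+y\in \mathrm{Id}(R)$. A ring is local if it has a unique maximal ideal; non-local otherwise. A graph is outerplanar if it can be embedded in the plane with all vertices on the outer face. *)

theory Defs
  imports "HOL-Algebra.Algebra" "HOL-Analysis.Analysis"
begin

definition local_ring :: "('a, 'm) ring_scheme \<Rightarrow> bool"
  where "local_ring R \<longleftrightarrow> (\<exists>!M. maximalideal M R)"

definition idempotents :: "('a, 'm) ring_scheme \<Rightarrow> 'a set"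
  where "idempotents R = {x \<in> carrier R. x [^]\<^bsub>R\<^esub> (2::nat) = x}"

text \<open>A simple undirected graph is a pair of a vertex set and a set of edges, each edge being
  a two-element set of vertices.\<close>

type_synonym 'a graph = "'a set \<times> 'a set set"

definition idempotent_graph :: "('a, 'm) ring_scheme \<Rightarrow> 'a graph"
  where "idempotent_graph R =
    (carrier R,
     {{x, y} | x y. x \<in> carrier R \<and> y \<in> carrier R \<and> x \<noteq> y \<and> x \<oplus>\<^bsub>R\<^esub> y \<in> idempotents R})"

text \<open>In an embedding into the plane, \<open>p v\<close> is the point representing the vertex \<open>v\<close> and
  \<open>\<gamma> e\<close> is a Jordan arc joining the points that represent the two ends of the edge \<open>e\<close>.
  An arc passes through no other vertex, and two arcs meet only in common ends.\<close>

definition plane_embedding ::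
    "'a graph \<Rightarrow> ('a \<Rightarrow> complex) \<Rightarrow> ('a set \<Rightarrow> real \<Rightarrow> complex) \<Rightarrow> bool"
  where "plane_embedding G p \<gamma> \<longleftrightarrow>
    inj_on p (fst G) \<and>
    (\<forall>e\<in>snd G. arc (\<gamma> e) \<and> {pathstart (\<gamma> e), pathfinish (\<gamma> e)} = p ` e \<and>
       path_image (\<gamma> e) \<inter> p ` fst G = p ` e) \<and>
    (\<forall>e\<in>snd G. \<forall>f\<in>snd G. e \<noteq> f \<longrightarrow> path_image (\<gamma> e) \<inter> path_image (\<gamma> f) = p ` (e \<inter> f))"

definition drawing ::
    "'a graph \<Rightarrow> ('a \<Rightarrow> complex) \<Rightarrow> ('a set \<Rightarrow> real \<Rightarrow> complex) \<Rightarrow> complex set"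
  where "drawing G p \<gamma> = p ` fst G \<union> (\<Union>e\<in>snd G. path_image (\<gamma> e))"

text \<open>For a finite graph the drawing is compact, so \<^const>\<open>outside\<close> of it is its unique unbounded
  face. A vertex is on the outer face if it lies on the boundary of that face. The definition
  is intended for finite graphs.\<close>

definition outerplanar :: "'a graph \<Rightarrow> bool"
  where "outerplanar G \<longleftrightarrow>
    (\<exists>p \<gamma>. plane_embedding G p \<gamma> \<and> p ` fst G \<subseteq> frontier (outside (drawing G p \<gamma>)))"

end

theory Submission
  imports Defs
begin

text \<open>A finite non-local commutative ring has an idempotent \<open>e\<close> other than \<open>0\<close> and \<open>1\<close>. Put
  \<open>f = 1 - e\<close>. The elements \<open>0\<close>, \<open>e\<close>, \<open>f\<close> are pairwise adjacent, \<open>0\<close> is adjacent to \<open>1\<close>, and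
  \<open>1\<close> is joined to \<open>e\<close> through \<open>-e\<close> and to \<open>f\<close> through \<open>-f\<close> (by an edge if \<open>e = -e\<close>, respectively
  \<open>f = -f\<close>). So the graph contains a subdivision of \<open>K\<^sub>4\<close>. In a drawing of it with all
  vertices on the outer face, consider the Jordan curve \<open>C\<close> through \<open>0\<close>, \<open>e\<close>, \<open>1\<close>, \<open>f\<close> and the two
  chords \<open>01\<close> and \<open>ef\<close>. A chord outside \<open>C\<close> would enclose a vertex, so both chords run inside
  \<open>C\<close>; but the first one splits the inside of \<open>C\<close> into two parts, and neither part has both ends
  of the second one on its boundary.\<close>

section \<open>Arcs and theta curves in the plane\<close>

text \<open>Keeping only the point set of an arc makes its orientation immaterial and turns
  conditions on meeting arcs into set equations.\<close>

definition arc_between :: "complex \<Rightarrow> complex \<Rightarrow> complex set \<Rightarrow> bool"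
  where "arc_between a b S \<longleftrightarrow>
    (\<exists>g. arc g \<and> pathstart g = a \<and> pathfinish g = b \<and> path_image g = S)"

lemma arc_betweenE:
  assumes "arc_between a b S"
  obtains g where "arc g" "pathstart g = a" "pathfinish g = b" "path_image g = S"
  using assms by (auto simp: arc_between_def)

lemma arc_between_sym:
  assumes "arc_between a b S"
  shows "arc_between b a S"
proof -
  obtain g where "arc g" "pathstart g = a" "pathfinish g = b" "path_image g = S"
    using assms by (rule arc_betweenE)
  then show ?thesis
    unfolding arc_between_def by (intro exI[of _ "reversepath g"]) (simp add: arc_reversepath)
qed

lemma arc_between_join:
  assumes "arc_between a b S" "arc_between b c T" "S \<inter> T \<subseteq> {b}"
  shows "arc_between a c (S \<union> T)"
proof -
  obtain g where g: "arc g" "pathstart g = a" "pathfinish g = b" "path_image g = S"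
    using assms(1) by (rule arc_betweenE)
  obtain h where h: "arc h" "pathstart h = b" "pathfinish h = c" "path_image h = T"
    using assms(2) by (rule arc_betweenE)
  show ?thesis
    unfolding arc_between_def using g h assms(3)
    by (intro exI[of _ "g +++ h"]) (auto simp: path_image_join intro!: arc_join)
qed

lemma arc_between_ends:
  assumes "arc_between a b S"
  shows "a \<in> S" "b \<in> S" "a \<noteq> b"
  using assms arc_distinct_ends by (fastforce elim!: arc_betweenE)+

lemma compact_arc_between: "arc_between a b S \<Longrightarrow> compact S"
  by (auto elim!: arc_betweenE simp: compact_arc_image)

lemma connected_arc_between: "arc_between a b S \<Longrightarrow> connected S"
  by (auto elim!: arc_betweenE simp: connected_arc_image)

text \<open>Meant for a chord that meets a curve only in one of its ends: the rest of the chord then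
  lies on one side of the curve.\<close>

lemma connected_arc_between_minus:
  assumes "arc_between a b S"
  shows "connected (S - {a})"
proof -
  obtain g where g: "arc g" "pathstart g = a" "pathfinish g = b" "path_image g = S"
    using assms by (rule arc_betweenE)
  have "g ` {0<..1} = S - {a}"
    using g inj_on_image_set_diff[of g "{0..1}" "{0..1}" "{0}"]
    by (auto simp: arc_def path_image_def pathstart_def greaterThanAtMost_eq_atLeastAtMost_diff)
  moreover have "continuous_on {0<..1} g"
    using g by (auto simp: arc_def path_def intro: continuous_on_subset)
  then have "connected (g ` {0<..1})"
    by (rule connected_continuous_image) (simp add: connected_Ioc)
  ultimately show ?thesis by simp
qed

text \<open>The Jordan curve theorem for the closed curve that runs along \<open>S\<close> and back
  along \<open>T\<close>.\<close>

lemma Jordan_two_arcs: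
  assumes "arc_between a b S" "arc_between a b T" "S \<inter> T = {a, b}"
  shows "connected (inside (S \<union> T))" "inside (S \<union> T) \<noteq> {}"
    "frontier (inside (S \<union> T)) = S \<union> T"
proof -
  obtain g where g: "arc g" "pathstart g = a" "pathfinish g = b" "path_image g = S"
    using assms(1) by (rule arc_betweenE)
  obtain h where h: "arc h" "pathstart h = b" "pathfinish h = a" "path_image h = T"
    using arc_between_sym[OF assms(2)] by (rule arc_betweenE)
  have *: "simple_path (g +++ h)" "pathfinish (g +++ h) = pathstart (g +++ h)"
    "path_image (g +++ h) = S \<union> T"
    using g h assms(3) by (auto simp: path_image_join intro!: simple_path_join_loop)
  show "connected (inside (S \<union> T))" "inside (S \<union> T) \<noteq> {}"
    "frontier (inside (S \<union> T)) = S \<union> T"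
    using Jordan_inside_outside[OF *(1,2)] *(3) by auto
qed

lemma inside_connected_subset:
  assumes "connected T" "T \<inter> S = {}" "x \<in> T" "x \<in> inside S"
  shows "T \<subseteq> inside S"
  using assms inside_same_component[of S x]
  by (metis connected_component_maximal disjoint_eq_subset_Compl mem_Collect_eq subset_eq)

text \<open>If \<open>S\<^sub>3\<close> missed the inside of
  \<open>S\<^sub>1 \<union> S\<^sub>2\<close>, a point \<open>x\<close> there would lie outside both
  other cycles. These meet in the connected set \<open>S\<^sub>3\<close>, so by Janiszewski's
  theorem \<open>x\<close> would lie outside the whole theta curve, hence outside
  \<open>S\<^sub>1 \<union> S\<^sub>2\<close>.\<close>

lemma theta_chord_inside:
  assumes arcs: "arc_between a b S\<^sub>1" "arc_between a b S\<^sub>2" "arc_between a b S\<^sub>3"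
    and int: "S\<^sub>1 \<inter> S\<^sub>2 = {a, b}" "S\<^sub>1 \<inter> S\<^sub>3 = {a, b}" "S\<^sub>2 \<inter> S\<^sub>3 = {a, b}"
    and u: "u \<in> S\<^sub>1 - {a, b}" "u \<notin> inside (S\<^sub>2 \<union> S\<^sub>3)"
    and v: "v \<in> S\<^sub>2 - {a, b}" "v \<notin> inside (S\<^sub>1 \<union> S\<^sub>3)"
  shows "S\<^sub>3 \<inter> inside (S\<^sub>1 \<union> S\<^sub>2) \<noteq> {}"
proof
  assume disj: "S\<^sub>3 \<inter> inside (S\<^sub>1 \<union> S\<^sub>2) = {}"
  let ?I = "inside (S\<^sub>1 \<union> S\<^sub>2)" and ?\<Theta> = "S\<^sub>1 \<union> S\<^sub>2 \<union> S\<^sub>3"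
  note J = Jordan_two_arcs[OF arcs(1,2) int(1)]
  note J13 = Jordan_two_arcs[OF arcs(1,3) int(2)]
  note J23 = Jordan_two_arcs[OF arcs(2,3) int(3)]
  have I\<Theta>: "?I \<inter> ?\<Theta> = {}"
    using disj inside_no_overlap[of "S\<^sub>1 \<union> S\<^sub>2"] by blast
  obtain x where x: "x \<in> ?I" using J(2) by blast
  have clI: "S\<^sub>1 \<union> S\<^sub>2 \<subseteq> closure ?I"
    using J(3) by (metis frontier_closures inf_le1)
  \<comment> \<open>Were \<open>x\<close> inside \<open>S \<union> S\<^sub>3\<close>, all of
    \<open>?I\<close> would be, and then \<open>w\<close>, a point of its closure, would lie inside
    or on that cycle.\<close>
  have out: "x \<in> outside (S \<union> S\<^sub>3)"
    if "S \<union> S\<^sub>3 \<subseteq> ?\<Theta>" and w: "w \<in> S\<^sub>1 \<union> S\<^sub>2" "w \<notin> S \<union> S\<^sub>3" "w \<notin> inside (S \<union> S\<^sub>3)"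
      and fr: "frontier (inside (S \<union> S\<^sub>3)) = S \<union> S\<^sub>3" for S w
  proof (rule ccontr)
    assume "x \<notin> outside (S \<union> S\<^sub>3)"
    moreover have "x \<notin> S \<union> S\<^sub>3" using x I\<Theta> that(1) by blast
    ultimately have "x \<in> inside (S \<union> S\<^sub>3)" using inside_Un_outside[of "S \<union> S\<^sub>3"] by blast
    moreover have "?I \<inter> (S \<union> S\<^sub>3) = {}" using I\<Theta> that(1) by blast
    ultimately have "?I \<subseteq> inside (S \<union> S\<^sub>3)"
      using inside_connected_subset[OF J(1)] x by blast
    then have "closure ?I \<subseteq> inside (S \<union> S\<^sub>3) \<union> (S \<union> S\<^sub>3)"
      using closure_mono fr closure_Un_frontier by metis
    with clI w show False by blast
  qed
  have "v \<notin> S\<^sub>1 \<union> S\<^sub>3" "u \<notin> S\<^sub>2 \<union> S\<^sub>3" using u v int by blast+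
  then have x13: "x \<in> outside (S\<^sub>1 \<union> S\<^sub>3)" and x23: "x \<in> outside (S\<^sub>2 \<union> S\<^sub>3)"
    using out[of S\<^sub>1 v] out[of S\<^sub>2 u] u v J13(3) J23(3) by blast+
  have comp: "compact (S\<^sub>1 \<union> S\<^sub>3)" "compact (S\<^sub>2 \<union> S\<^sub>3)" "compact ?\<Theta>"
    using arcs compact_arc_between by (blast intro: compact_Un)+
  \<comment> \<open>A reference point in the unbounded face; neither cycle through
    \<open>S\<^sub>3\<close> separates it from \<open>x\<close>.\<close>
  then obtain y where y: "y \<in> outside ?\<Theta>"
    using outside_bounded_nonempty compact_imp_bounded by blast
  have cc: "connected_component (- T) y x" if "compact T" "T \<subseteq> ?\<Theta>" "x \<in> outside T" for T
  proof -
    have "connected (outside T)"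
      using that(1) by (intro connected_outside) (auto simp: compact_imp_bounded)
    moreover have "y \<in> outside T" using y outside_mono[OF that(2)] by blast
    moreover have "outside T \<subseteq> - T" by (auto simp: outside_def)
    ultimately show ?thesis using that(3) unfolding connected_component_def by blast
  qed
  have "(S\<^sub>1 \<union> S\<^sub>3) \<inter> (S\<^sub>2 \<union> S\<^sub>3) = S\<^sub>3"
    using int by blast
  then have "connected_component (- ((S\<^sub>1 \<union> S\<^sub>3) \<union> (S\<^sub>2 \<union> S\<^sub>3))) y x"
    using arcs(3) comp x13 x23
    by (intro Janiszewski cc) (auto simp: connected_arc_between compact_imp_closed)
  moreover have "(S\<^sub>1 \<union> S\<^sub>3) \<union> (S\<^sub>2 \<union> S\<^sub>3) = ?\<Theta>" by blast
  ultimately have "x \<in> outside ?\<Theta>"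
    using y outside_same_component by metis
  then have "x \<in> outside (S\<^sub>1 \<union> S\<^sub>2)" using outside_mono[of "S\<^sub>1 \<union> S\<^sub>2" ?\<Theta>] by blast
  with x show False using inside_Int_outside by blast
qed

lemma chord_split_inside:
  assumes "arc_between a b S\<^sub>1" "arc_between a b S\<^sub>2" "arc_between a b S\<^sub>3"
    and "S\<^sub>1 \<inter> S\<^sub>2 = {a, b}" "S\<^sub>1 \<inter> S\<^sub>3 = {a, b}" "S\<^sub>2 \<inter> S\<^sub>3 = {a, b}"
    and "S\<^sub>3 \<inter> inside (S\<^sub>1 \<union> S\<^sub>2) \<noteq> {}"
  shows "inside (S\<^sub>1 \<union> S\<^sub>2) = inside (S\<^sub>1 \<union> S\<^sub>3) \<union> inside (S\<^sub>2 \<union> S\<^sub>3) \<union> (S\<^sub>3 - {a, b})"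
proof -
  obtain g where g: "arc g" "pathstart g = a" "pathfinish g = b" "path_image g = S\<^sub>1"
    using assms(1) by (rule arc_betweenE)
  obtain h where h: "arc h" "pathstart h = a" "pathfinish h = b" "path_image h = S\<^sub>2"
    using assms(2) by (rule arc_betweenE)
  obtain k where k: "arc k" "pathstart k = a" "pathfinish k = b" "path_image k = S\<^sub>3"
    using assms(3) by (rule arc_betweenE)
  show ?thesis
    by (rule split_inside_simple_closed_curve[of g a b h k])
      (use g h k assms arc_between_ends(3)[OF assms(1)] in
        \<open>auto simp: arc_imp_simple_path\<close>)
qed

text \<open>\<open>S\<^sub>3\<close> cuts the inside into two parts. A point of \<open>T\<close> in
  one of them would drag along the end of \<open>T\<close> on the opposite side, but that end lies
  on the curve itself.\<close>

lemma crossing_chords_not_both_inside: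
  assumes arcs: "arc_between a b S\<^sub>1" "arc_between a b S\<^sub>2" "arc_between a b S\<^sub>3"
    and int: "S\<^sub>1 \<inter> S\<^sub>2 = {a, b}" "S\<^sub>1 \<inter> S\<^sub>3 = {a, b}" "S\<^sub>2 \<inter> S\<^sub>3 = {a, b}"
    and inside: "S\<^sub>3 \<inter> inside (S\<^sub>1 \<union> S\<^sub>2) \<noteq> {}"
    and T: "arc_between c d T" "S\<^sub>1 \<inter> T = {c}" "S\<^sub>2 \<inter> T = {d}" "S\<^sub>3 \<inter> T = {}"
  shows "T \<inter> inside (S\<^sub>1 \<union> S\<^sub>2) = {}"
proof (rule ccontr)
  assume "T \<inter> inside (S\<^sub>1 \<union> S\<^sub>2) \<noteq> {}"
  then obtain x where x: "x \<in> T" "x \<in> inside (S\<^sub>1 \<union> S\<^sub>2)" by blast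
  note split = chord_split_inside[OF arcs int inside]
  have no: "c \<notin> inside (S\<^sub>1 \<union> S\<^sub>2)" "d \<notin> inside (S\<^sub>1 \<union> S\<^sub>2)"
    using T inside_no_overlap[of "S\<^sub>1 \<union> S\<^sub>2"] by blast+
  have "c \<noteq> d" using arc_between_ends[OF T(1)] by blast
  have cd: "c \<in> T" "d \<in> T" using arc_between_ends[OF T(1)] by blast+
  from x split T(4) consider "x \<in> inside (S\<^sub>1 \<union> S\<^sub>3)" | "x \<in> inside (S\<^sub>2 \<union> S\<^sub>3)" by blast
  then show False
  proof cases
    case 1
    \<comment> \<open>\<open>T - {c}\<close> avoids \<open>S\<^sub>1 \<union> S\<^sub>3\<close> and
      still contains \<open>d\<close>, which lies on \<open>S\<^sub>2\<close>.\<close>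
    have "T - {c} \<subseteq> inside (S\<^sub>1 \<union> S\<^sub>3)"
      by (rule inside_connected_subset[of _ _ x])
        (use 1 x T no connected_arc_between_minus[OF T(1)] in auto)
    with cd \<open>c \<noteq> d\<close> split no show False by blast
  next
    case 2
    have "T - {d} \<subseteq> inside (S\<^sub>2 \<union> S\<^sub>3)"
      by (rule inside_connected_subset[of _ _ x])
        (use 2 x T no connected_arc_between_minus[OF arc_between_sym[OF T(1)]] in auto)
    with cd \<open>c \<noteq> d\<close> split no show False by blast
  qed
qed

text \<open>The set named \<open>T\<close> with two indices is the arc joining the two corresponding
  vertices of \<open>K\<^sub>4\<close>; the cycle is \<open>a c b d\<close>, its chords are \<open>ab\<close> and \<open>cd\<close>.\<close>

lemma K4_not_all_vertices_outer:
  assumes arcs: "arc_between a b Tab" "arc_between c d Tcd" "arc_between a c Tac"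
      "arc_between a d Tad" "arc_between b c Tbc" "arc_between b d Tbd"
    and int: "Tab \<inter> Tcd = {}" "Tac \<inter> Tbd = {}" "Tad \<inter> Tbc = {}"
      "Tab \<inter> Tac = {a}" "Tab \<inter> Tad = {a}" "Tac \<inter> Tad = {a}"
      "Tab \<inter> Tbc = {b}" "Tab \<inter> Tbd = {b}" "Tbc \<inter> Tbd = {b}"
      "Tcd \<inter> Tac = {c}" "Tcd \<inter> Tbc = {c}" "Tac \<inter> Tbc = {c}"
      "Tcd \<inter> Tad = {d}" "Tcd \<inter> Tbd = {d}" "Tad \<inter> Tbd = {d}"
    and D: "Tab \<union> Tcd \<union> Tac \<union> Tad \<union> Tbc \<union> Tbd \<subseteq> D"
  shows "\<not> {a, b, c, d} \<subseteq> closure (outside D)"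
proof
  assume outer: "{a, b, c, d} \<subseteq> closure (outside D)"
  have compact: "compact Tab" "compact Tcd" "compact Tac" "compact Tad" "compact Tbc" "compact Tbd"
    using arcs compact_arc_between by blast+
  \<comment> \<open>Shrinking \<open>D\<close> to \<open>S\<close> only enlarges the outside, so
    \<open>w\<close> is a limit of points outside \<open>S\<close>; the open set
    \<open>inside S\<close> contains none of these.\<close>
  have not_inside: "w \<notin> inside S" if "w \<in> {a, b, c, d}" "compact S" "S \<subseteq> D" for w S
  proof
    assume w: "w \<in> inside S"
    have "open (inside S)" using that(2) by (simp add: open_inside compact_imp_closed)
    moreover have "w \<in> closure (outside S)"
      using that outer closure_mono[OF outside_mono[OF that(3)]] by blast
    ultimately have "inside S \<inter> outside S \<noteq> {}"
      using w by (metis IntI closure_iff_nhds_not_empty empty_iff open_Int_closure_eq_empty)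
    then show False by simp
  qed
  note ends = arcs[THEN arc_between_ends(1)] arcs[THEN arc_between_ends(2)]
    arcs[THEN arc_between_ends(3)]
  \<comment> \<open>The same cycle is cut at \<open>a\<close>, \<open>b\<close> into
    \<open>P\<close>, \<open>Q\<close> and at \<open>c\<close>, \<open>d\<close> into
    \<open>P'\<close>, \<open>Q'\<close>. Each chord thus forms a theta curve with two halves of the
    cycle, and the ends of the other chord serve as the points that are not enclosed.\<close>
  define P where "P = Tac \<union> Tbc"
  define Q where "Q = Tad \<union> Tbd"
  define P' where "P' = Tac \<union> Tad"
  define Q' where "Q' = Tbc \<union> Tbd"
  note defs = P_def Q_def P'_def Q'_def
  have PQ: "arc_between a b P" "arc_between a b Q"
    unfolding defs using arc_between_join[OF arcs(3) arc_between_sym[OF arcs(5)]]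
      arc_between_join[OF arcs(4) arc_between_sym[OF arcs(6)]] int(12,15) by simp_all
  have PQ': "arc_between c d P'" "arc_between c d Q'"
    unfolding defs using arc_between_join[OF arc_between_sym[OF arcs(3)] arcs(4)]
      arc_between_join[OF arc_between_sym[OF arcs(5)] arcs(6)] int(6,9) by simp_all
  have iPQ: "P \<inter> Q = {a, b}" "P \<inter> Tab = {a, b}" "Q \<inter> Tab = {a, b}"
    by (simp_all add: defs Int_Un_distrib Int_Un_distrib2 int Int_commute[of _ Tab]
        Int_commute[of Tbc Tad] insert_commute)
  have iPQ': "P' \<inter> Q' = {c, d}" "P' \<inter> Tcd = {c, d}" "Q' \<inter> Tcd = {c, d}"
    by (simp_all add: defs Int_Un_distrib Int_Un_distrib2 int Int_commute[of _ Tcd]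
        Int_commute[of Tad Tbc] insert_commute)
  have in1: "Tab \<inter> inside (P \<union> Q) \<noteq> {}"
  proof (rule theta_chord_inside[OF PQ arcs(1) iPQ])
    show "c \<in> P - {a, b}" "d \<in> Q - {a, b}" using ends by (auto simp: defs)
    show "c \<notin> inside (Q \<union> Tab)" "d \<notin> inside (P \<union> Tab)"
      using D compact by (simp_all add: not_inside compact_Un defs)
  qed
  have in2: "Tcd \<inter> inside (P' \<union> Q') \<noteq> {}"
  proof (rule theta_chord_inside[OF PQ' arcs(2) iPQ'])
    show "a \<in> P' - {c, d}" "b \<in> Q' - {c, d}" using ends by (auto simp: defs)
    show "a \<notin> inside (Q' \<union> Tcd)" "b \<notin> inside (P' \<union> Tcd)"
      using D compact by (simp_all add: not_inside compact_Un defs)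
  qed
  have "Tcd \<inter> inside (P \<union> Q) = {}"
    by (rule crossing_chords_not_both_inside[OF PQ arcs(1) iPQ in1 arcs(2)])
      (use int in \<open>auto simp: defs\<close>)
  moreover have "P \<union> Q = P' \<union> Q'" by (auto simp: defs)
  ultimately show False using in2 by simp
qed

section \<open>Subdivisions of the complete graph on four vertices\<close>

text \<open>A path given by its edge set \<open>F\<close>, so that \<open>\<Union>F\<close> is its
  vertex set; the freshness condition in \<open>step\<close> keeps it from revisiting a
  vertex.\<close>

inductive joins :: "'a set set \<Rightarrow> 'a \<Rightarrow> 'a \<Rightarrow> 'a set set \<Rightarrow> bool" for E where
  edge: "\<lbrakk>{x, y} \<in> E; x \<noteq> y\<rbrakk> \<Longrightarrow> joins E x y {{x, y}}"
| step: "\<lbrakk>{x, y} \<in> E; joins E y z F; x \<notin> \<Union>F\<rbrakk> \<Longrightarrow> joins E x z (insert {x, y} F)"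

lemma joins_subset: "joins E x y F \<Longrightarrow> F \<subseteq> E"
  by (induction rule: joins.induct) auto

lemma joins_ends: "joins E x y F \<Longrightarrow> x \<in> \<Union>F \<and> y \<in> \<Union>F"
  by (induction rule: joins.induct) auto

text \<open>Ensures that two paths with at most one common vertex have no common edge.\<close>

lemma joins_edge_not_singleton: "joins E x y F \<Longrightarrow> e \<in> F \<Longrightarrow> \<not> e \<subseteq> {w}"
proof (induction rule: joins.induct)
  case (step x y z F)
  then show ?case using joins_ends[of E y z F] by auto
qed auto

lemma plane_embedding_Int:
  assumes "plane_embedding G p \<gamma>" "F \<subseteq> snd G" "F' \<subseteq> snd G" "F \<inter> F' = {}"
  shows "(\<Union>e\<in>F. path_image (\<gamma> e)) \<inter> (\<Union>e\<in>F'. path_image (\<gamma> e)) = p ` (\<Union>F \<inter> \<Union>F')"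
proof -
  have *: "path_image (\<gamma> e) \<inter> path_image (\<gamma> f) = p ` (e \<inter> f)" if "e \<in> F" "f \<in> F'" for e f
  proof -
    have "e \<in> snd G" "f \<in> snd G" "e \<noteq> f" using assms(2-4) that by auto
    then show ?thesis using assms(1) unfolding plane_embedding_def by simp
  qed
  have "(\<Union>e\<in>F. path_image (\<gamma> e)) \<inter> (\<Union>e\<in>F'. path_image (\<gamma> e)) =
      (\<Union>e\<in>F. \<Union>f\<in>F'. path_image (\<gamma> e) \<inter> path_image (\<gamma> f))" by blast
  also have "\<dots> = (\<Union>e\<in>F. \<Union>f\<in>F'. p ` (e \<inter> f))" using * by simp
  also have "\<dots> = p ` (\<Union>e\<in>F. \<Union>f\<in>F'. e \<inter> f)" by (simp only: image_UN)
  also have "(\<Union>e\<in>F. \<Union>f\<in>F'. e \<inter> f) = \<Union>F \<inter> \<Union>F'" by blast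
  finally show ?thesis .
qed

lemma plane_embedding_arc_between_edge:
  assumes "plane_embedding G p \<gamma>" "{x, y} \<in> snd G"
  shows "arc_between (p x) (p y) (path_image (\<gamma> {x, y}))"
proof -
  let ?g = "\<gamma> {x, y}"
  have g: "arc ?g" "{pathstart ?g, pathfinish ?g} = {p x, p y}"
    using assms unfolding plane_embedding_def by auto
  \<comment> \<open>The embedding determines only the unordered pair of ends, so either orientation
    may occur.\<close>
  then have "arc_between (pathstart ?g) (pathfinish ?g) (path_image ?g)"
    by (auto simp: arc_between_def)
  with g(2) show ?thesis by (metis arc_between_sym doubleton_eq_iff)
qed

text \<open>The arc of the first edge is joined to the arc of the remaining path; as
  \<open>x\<close> is fresh, the two meet only in \<open>p y\<close>.\<close>

lemma plane_embedding_arc_between: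
  assumes "plane_embedding G p \<gamma>" "joins (snd G) x y F"
  shows "arc_between (p x) (p y) (\<Union>e\<in>F. path_image (\<gamma> e))"
  using assms(2)
proof (induction rule: joins.induct)
  case (edge x y)
  then show ?case using plane_embedding_arc_between_edge[OF assms(1)] by simp
next
  case (step x y z F)
  have "{x, y} \<notin> F" using step by blast
  then have "path_image (\<gamma> {x, y}) \<inter> (\<Union>e\<in>F. path_image (\<gamma> e)) = p ` ({x, y} \<inter> \<Union>F)"
    using plane_embedding_Int[OF assms(1), of "{{x, y}}" F] step joins_subset[of "snd G" y z F]
    by auto
  also have "\<dots> \<subseteq> {p y}" using step by auto
  finally show ?case
    using arc_between_join[OF plane_embedding_arc_between_edge[OF assms(1)]] step by simp
qed

lemma K4_subdivision_not_outerplanar: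
  assumes paths: "joins (snd G) a b Fab" "joins (snd G) c d Fcd" "joins (snd G) a c Fac"
      "joins (snd G) a d Fad" "joins (snd G) b c Fbc" "joins (snd G) b d Fbd"
    and int: "\<Union>Fab \<inter> \<Union>Fcd = {}" "\<Union>Fac \<inter> \<Union>Fbd = {}" "\<Union>Fad \<inter> \<Union>Fbc = {}"
      "\<Union>Fab \<inter> \<Union>Fac = {a}" "\<Union>Fab \<inter> \<Union>Fad = {a}" "\<Union>Fac \<inter> \<Union>Fad = {a}"
      "\<Union>Fab \<inter> \<Union>Fbc = {b}" "\<Union>Fab \<inter> \<Union>Fbd = {b}" "\<Union>Fbc \<inter> \<Union>Fbd = {b}"
      "\<Union>Fcd \<inter> \<Union>Fac = {c}" "\<Union>Fcd \<inter> \<Union>Fbc = {c}" "\<Union>Fac \<inter> \<Union>Fbc = {c}"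
      "\<Union>Fcd \<inter> \<Union>Fad = {d}" "\<Union>Fcd \<inter> \<Union>Fbd = {d}" "\<Union>Fad \<inter> \<Union>Fbd = {d}"
    and vertices: "{a, b, c, d} \<subseteq> fst G"
  shows "\<not> outerplanar G"
proof
  assume "outerplanar G"
  then obtain p \<gamma> where emb: "plane_embedding G p \<gamma>"
    and outer: "p ` fst G \<subseteq> frontier (outside (drawing G p \<gamma>))"
    unfolding outerplanar_def by blast
  let ?D = "\<lambda>F. \<Union>e\<in>F. path_image (\<gamma> e)"
  \<comment> \<open>Sharing at most the vertex \<open>w\<close>, the two paths have disjoint edge
    sets, so their drawings meet only in images of common vertices.\<close>
  have Int: "?D F \<inter> ?D F' = p ` (\<Union>F \<inter> \<Union>F')"
    if "joins (snd G) x y F" "joins (snd G) x' y' F'" "\<Union>F \<inter> \<Union>F' \<subseteq> {w}" for x y F x' y' F' w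
  proof (rule plane_embedding_Int[OF emb])
    show "F \<subseteq> snd G" "F' \<subseteq> snd G" using that joins_subset by metis+
    show "F \<inter> F' = {}"
      using that joins_edge_not_singleton[OF that(1), of _ w] by blast
  qed
  note arcs = paths[THEN plane_embedding_arc_between[OF emb]]
  have "\<not> {p a, p b, p c, p d} \<subseteq> closure (outside (drawing G p \<gamma>))"
  proof (rule K4_not_all_vertices_outer[OF arcs])
    have "?D F \<subseteq> drawing G p \<gamma>" if "joins (snd G) x y F" for x y F
      using joins_subset[OF that] by (auto simp: drawing_def)
    from paths[THEN this]
    show "?D Fab \<union> ?D Fcd \<union> ?D Fac \<union> ?D Fad \<union> ?D Fbc \<union> ?D Fbd \<subseteq> drawing G p \<gamma>"
      by (simp only: Un_least)
  qed (subst Int, (rule paths)+, use int in simp_all)+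
  moreover have "{p a, p b, p c, p d} \<subseteq> p ` fst G" using vertices by blast
  ultimately show False
    using outer by (metis Diff_subset frontier_def order_trans)
qed

section \<open>Idempotents of finite commutative rings\<close>

lemma (in monoid) finite_power_idempotent:
  assumes "finite (carrier G)" "x \<in> carrier G"
  obtains k :: nat where "k > 0" "x [^] k \<otimes> x [^] k = x [^] k"
proof -
  \<comment> \<open>Pigeonhole; the exponents start at 1 so that \<open>m\<close>, and later
    \<open>m * d\<close>, is positive.\<close>
  have "\<not> inj_on (\<lambda>n::nat. x [^] n) {1..}"
    using assms by (metis finite_imageD finite_subset image_subsetI infinite_Ici nat_pow_closed)
  then obtain m n :: nat where "m \<ge> 1" "n \<ge> 1" "m \<noteq> n" and mn: "x [^] m = x [^] n"
    unfolding inj_on_def by auto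
  then obtain m d :: nat where m: "m > 0" "d > 0" and eq: "x [^] (m + d) = x [^] m"
    by (metis One_nat_def Suc_le_eq less_imp_add_positive linorder_neqE_nat)
  have per: "x [^] (j + d) = x [^] j" if "j \<ge> m" for j
  proof -
    have "x [^] (j + d) = x [^] (m + d) \<otimes> x [^] (j - m)"
      using that assms by (simp add: nat_pow_mult add.commute)
    also have "\<dots> = x [^] j" using that assms by (simp add: eq nat_pow_mult)
    finally show ?thesis .
  qed
  \<comment> \<open>\<open>m * d\<close> is a multiple of the period \<open>d\<close> and at least
    \<open>m\<close>; the choice \<open>i = m\<close> doubles the exponent.\<close>
  have "x [^] (m * d + i * d) = x [^] (m * d)" for i
  proof (induction i)
    case (Suc i)
    have "m \<le> m * d + i * d" using m by (simp add: trans_le_add1)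
    then have "x [^] (m * d + i * d + d) = x [^] (m * d + i * d)" by (rule per)
    then show ?case using Suc by (simp add: algebra_simps)
  qed simp
  then have "x [^] (m * d) \<otimes> x [^] (m * d) = x [^] (m * d)"
    using assms by (simp add: nat_pow_mult)
  with m show ?thesis by (intro that[of "m * d"]) auto
qed

lemma (in cring) finite_maximalideal_exists:
  assumes "finite (carrier R)" "\<one> \<noteq> \<zero>"
  obtains M where "maximalideal M R"
proof -
  let ?A = "{I. ideal I R \<and> I \<noteq> carrier R}"
  have "?A \<subseteq> Pow (carrier R)"
    using ideal.Icarr by fastforce
  then have "finite ?A" using assms(1) finite_subset by blast
  moreover have "{\<zero>} \<in> ?A" using zeroideal assms(2) by auto
  ultimately have "\<exists>M\<in>?A. \<forall>I\<in>?A. M \<subseteq> I \<longrightarrow> M = I"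
    by (intro finite_has_maximal) auto
  then obtain M where M: "M \<in> ?A" "\<And>I. I \<in> ?A \<Longrightarrow> M \<subseteq> I \<Longrightarrow> M = I" by blast
  have "maximalideal M R"
    using M by (intro maximalidealI) auto
  then show ?thesis by (rule that)
qed

lemma (in primeideal) nat_pow_mem:
  assumes "x \<in> carrier R" "x [^] (k::nat) \<in> I"
  shows "x \<in> I"
  using assms(2)
proof (induction k)
  case 0
  then show ?case using one_imp_carrier assms(1) by auto
next
  case (Suc k)
  then show ?case using I_prime[of "x [^] k" x] assms(1) by auto
qed

text \<open>An element of one maximal ideal has a positive power that is idempotent and not
  \<open>\<one>\<close>, hence \<open>\<zero>\<close>. By primeness the element lies in every other
  maximal ideal, so all maximal ideals coincide.\<close>

lemma (in cring) finite_local_if_idempotents_trivial: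
  assumes fin: "finite (carrier R)" and "\<one> \<noteq> \<zero>"
    and triv: "\<And>e. e \<in> carrier R \<Longrightarrow> e \<otimes> e = e \<Longrightarrow> e = \<zero> \<or> e = \<one>"
  shows "local_ring R"
proof -
  have sub: "M \<subseteq> M'" if M: "maximalideal M R" and M': "maximalideal M' R" for M M'
  proof
    interpret M: maximalideal M R by fact
    interpret M': primeideal M' R using maximalideal_prime[OF M'] .
    fix x assume x: "x \<in> M"
    then have xR: "x \<in> carrier R" by (rule M.Icarr)
    obtain k :: nat where k: "k > 0" "x [^] k \<otimes> x [^] k = x [^] k"
      using finite_power_idempotent[OF fin xR] .
    \<comment> \<open>Here \<open>k > 0\<close> matters: a factor \<open>x\<close> puts the power
      into \<open>M\<close>.\<close>
    have "x [^] k = x \<otimes> x [^] (k - 1)"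
      using k(1) xR by (metis Suc_diff_1 nat_pow_Suc2)
    then have "x [^] k \<in> M" using x xR by (simp add: M.I_r_closed)
    then have "x [^] k \<noteq> \<one>" using M.one_imp_carrier M.I_notcarr by metis
    then have "x [^] k = \<zero>" using triv[OF _ k(2)] xR by auto
    then show "x \<in> M'"
      using M'.nat_pow_mem[OF xR, of k] M'.zero_closed by simp
  qed
  obtain M where "maximalideal M R"
    using finite_maximalideal_exists[OF fin assms(2)] .
  then show ?thesis unfolding local_ring_def using sub by blast
qed

lemma (in cring) idempotent_graph_edgeI:
  assumes "x \<in> carrier R" "y \<in> carrier R" "x \<noteq> y" "x \<oplus> y \<in> idempotents R"
  shows "{x, y} \<in> snd (idempotent_graph R)"
  using assms unfolding idempotent_graph_def by auto

lemma (in cring) mem_idempotents_iff: "x \<in> idempotents R \<longleftrightarrow> x \<in> carrier R \<and> x \<otimes> x = x"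
  by (auto simp: idempotents_def numeral_2_eq_2)

text \<open>The path passes through \<open>\<ominus> e\<close>, with edge sums
  \<open>\<one> \<ominus> e\<close> and \<open>\<zero>\<close>. If \<open>\<ominus> e = e\<close> it
  shrinks to one edge, yet the same formula describes its vertex set.\<close>

lemma (in cring) idempotent_graph_joins_one:
  assumes e: "e \<in> carrier R" "e \<noteq> \<one>" "\<ominus> e \<noteq> \<one>" and idem: "\<one> \<ominus> e \<in> idempotents R"
  obtains F where "joins (snd (idempotent_graph R)) \<one> e F" "\<Union>F = {\<one>, e, \<ominus> e}"
proof (cases "\<ominus> e = e")
  case True
  have "joins (snd (idempotent_graph R)) \<one> e {{\<one>, e}}"
    using e idem True
    by (intro joins.edge idempotent_graph_edgeI) (auto simp: minus_eq)
  then show ?thesis using that True by auto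
next
  case False
  have "{\<one>, \<ominus> e} \<in> snd (idempotent_graph R)"
    using e idem by (intro idempotent_graph_edgeI) (auto simp: minus_eq)
  moreover have "joins (snd (idempotent_graph R)) (\<ominus> e) e {{\<ominus> e, e}}"
    using e False
    by (intro joins.edge idempotent_graph_edgeI) (auto simp: l_neg mem_idempotents_iff)
  moreover have "\<one> \<notin> \<Union>{{\<ominus> e, e}}" using e by auto
  ultimately have "joins (snd (idempotent_graph R)) \<one> e (insert {\<one>, \<ominus> e} {{\<ominus> e, e}})"
    by (rule joins.step)
  then show ?thesis by (rule that) auto
qed

theorem theorem3p1:
  fixes R :: "('a, 'm) ring_scheme"
  assumes "cring R"
    and "finite (carrier R)"
    and "\<one>\<^bsub>R\<^esub> \<noteq> \<zero>\<^bsub>R\<^esub>"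
    and "\<not> local_ring R"
  shows "\<not> outerplanar (idempotent_graph R)"
proof -
  interpret cring R by fact
  let ?G = "idempotent_graph R"
  obtain e where e: "e \<in> carrier R" "e \<otimes>\<^bsub>R\<^esub> e = e" "e \<noteq> \<zero>\<^bsub>R\<^esub>" "e \<noteq> \<one>\<^bsub>R\<^esub>"
    using finite_local_if_idempotents_trivial assms by blast
  define f where "f = \<one>\<^bsub>R\<^esub> \<ominus>\<^bsub>R\<^esub> e"
  have f: "f \<in> carrier R" using e by (simp add: f_def)
  have ef: "e \<otimes>\<^bsub>R\<^esub> f = \<zero>\<^bsub>R\<^esub>"
    using e by (simp add: f_def minus_eq r_distr r_minus r_neg)
  have e_plus_f: "e \<oplus>\<^bsub>R\<^esub> f = \<one>\<^bsub>R\<^esub>"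
    using e by (simp add: f_def minus_eq a_lcomm[of e "\<one>\<^bsub>R\<^esub>"] r_neg)
  have e_eq: "\<one>\<^bsub>R\<^esub> \<ominus>\<^bsub>R\<^esub> f = e"
    using e f e_plus_f by (metis a_ac(2) add.inv_solve_right minus_eq one_closed)
  have ff: "f \<otimes>\<^bsub>R\<^esub> f = f"
  proof -
    have "f = (e \<oplus>\<^bsub>R\<^esub> f) \<otimes>\<^bsub>R\<^esub> f" using e_plus_f f by simp
    also have "\<dots> = f \<otimes>\<^bsub>R\<^esub> f" using e f ef by (simp add: l_distr)
    finally show ?thesis by simp
  qed
  have f0: "f \<noteq> \<zero>\<^bsub>R\<^esub>" "f \<noteq> \<one>\<^bsub>R\<^esub>"
    using e_plus_f ef e f by auto
  have idem: "\<zero>\<^bsub>R\<^esub> \<in> idempotents R" "\<one>\<^bsub>R\<^esub> \<in> idempotents R" "e \<in> idempotents R" "f \<in> idempotents R"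
    using e f ff by (auto simp: mem_idempotents_iff)
  have neg: "\<ominus>\<^bsub>R\<^esub> e \<noteq> \<zero>\<^bsub>R\<^esub>" "\<ominus>\<^bsub>R\<^esub> f \<noteq> \<zero>\<^bsub>R\<^esub>"
    using e f f0 by (metis minus_minus minus_zero)+
  have ne: "e \<noteq> f" using e ef by auto
  \<comment> \<open>Multiplying \<open>\<ominus> e = \<one>\<close> by \<open>f\<close> gives
    \<open>f = \<zero>\<close>, and \<open>\<ominus> f = \<one>\<close> by \<open>e\<close> gives
    \<open>e = \<zero>\<close>.\<close>
  have ne1: "\<ominus>\<^bsub>R\<^esub> e \<noteq> \<one>\<^bsub>R\<^esub>" "\<ominus>\<^bsub>R\<^esub> f \<noteq> \<one>\<^bsub>R\<^esub>"
    using e f ef f0 by (metis l_minus l_one minus_zero, metis r_minus r_one minus_zero)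
  have ne2: "\<ominus>\<^bsub>R\<^esub> e \<noteq> f" "\<ominus>\<^bsub>R\<^esub> f \<noteq> e" "\<ominus>\<^bsub>R\<^esub> e \<noteq> \<ominus>\<^bsub>R\<^esub> f"
  proof -
    \<comment> \<open>Multiplying \<open>\<ominus> e = f\<close> by \<open>e\<close> would give
      \<open>\<ominus> e = \<zero>\<close>.\<close>
    show "\<ominus>\<^bsub>R\<^esub> e \<noteq> f" using e ef neg by (metis r_minus)
    then show "\<ominus>\<^bsub>R\<^esub> f \<noteq> e" using f by (metis minus_minus)
    show "\<ominus>\<^bsub>R\<^esub> e \<noteq> \<ominus>\<^bsub>R\<^esub> f" using e f ne by (metis minus_minus)
  qed
  have edges: "joins (snd ?G) \<zero>\<^bsub>R\<^esub> \<one>\<^bsub>R\<^esub> {{\<zero>\<^bsub>R\<^esub>, \<one>\<^bsub>R\<^esub>}}" "joins (snd ?G) e f {{e, f}}"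
    "joins (snd ?G) \<zero>\<^bsub>R\<^esub> e {{\<zero>\<^bsub>R\<^esub>, e}}" "joins (snd ?G) \<zero>\<^bsub>R\<^esub> f {{\<zero>\<^bsub>R\<^esub>, f}}"
    using e f f0 ne idem e_plus_f assms(3)
    by (auto intro!: joins.edge idempotent_graph_edgeI)
  obtain Fe where Fe: "joins (snd ?G) \<one>\<^bsub>R\<^esub> e Fe" "\<Union>Fe = {\<one>\<^bsub>R\<^esub>, e, \<ominus>\<^bsub>R\<^esub> e}"
    using idempotent_graph_joins_one[of e] e ne1 idem by (metis f_def)
  obtain Ff where Ff: "joins (snd ?G) \<one>\<^bsub>R\<^esub> f Ff" "\<Union>Ff = {\<one>\<^bsub>R\<^esub>, f, \<ominus>\<^bsub>R\<^esub> f}"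
    using idempotent_graph_joins_one[of f] f f0 ne1 idem e_eq by metis
  \<comment> \<open>The branch vertices \<open>a\<close>, \<open>b\<close>, \<open>c\<close>,
    \<open>d\<close> are \<open>\<zero>\<close>, \<open>\<one>\<close>, \<open>e\<close>,
    \<open>f\<close>. The inequalities keep the paths from \<open>\<one>\<close> to \<open>e\<close>
    and \<open>f\<close> apart except at \<open>\<one>\<close>, and away from the other
    vertices.\<close>
  show ?thesis
    by (rule K4_subdivision_not_outerplanar[OF edges Fe(1) Ff(1)])
      (use Fe(2) Ff(2) e f f0 neg ne ne1 ne2 assms(3) in \<open>auto simp: idempotent_graph_def\<close>)
qed

end
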